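(* Let $Q$ be an FG-quasigroup. Then there exists a bijection between the set of arithmetic forms of $Q$ and the set $Q$, and this bijection restricts to a bijection between the set of strong arithmetic forms of $Q$ and the set $M(Q)=\{a\in Q:\ xa\cdot yx=xy\cdot ax\ \text{ for all } x,y\in Q\}$.
   Context: A quasigroup is a non-empty set $Q$ with a binary operation (written multiplicatively) such that all left translations $L_a:x\mapsto ax$ and all right translations $R_a:x\mapsto xa$ are permutations of $Q$. Juxtaposition binds more tightly than $\cdot$, so $xy\cdot zw$ means $(xy)(zw)$. In a quasigroup the maps $\alpha,\beta:Q\to Q$ are defined by $x\,\alpha(x)=x=\beta(x)\,x$. $Q$ is a left F-quasigroup if $x\cdot yz = xy\cdot\alpha(x)z$ for all $x,y,z\in Q$; a right F-quasigroup if $zy\cdot x = z\beta(x)\cdot yx$ for all $x,y,z\in Q$; an F-quasigroup if it is both. A quasigroup $(Q,\cdot)$ is isotopic to a group $(G,+)$ if there are bijections $a,b,c:Q\to G$ with $c(xy)=a(x)+b(y)$ for all $x,y\in Q$. An FG-quasigroup is an F-quasigroup isotopic to a (possibly noncommutative) group. Groups are written additively even when noncommutative; $Z(Q,+)$ denotes the center of $(Q,+)$. An arithmetic form of a quasigroup $Q$ is a five-tuple $(Q,+,f,g,e)$ such that: $(Q,+)$ is a (possibly noncommutative) group on the underlying set of $Q$; $f,g$ are automorphisms of $(Q,+)$; $fg=gf$; $-x+f(x)\in Z(Q,+)$ and $-x+g(x)\in Z(Q,+)$ for all $x\in Q$; $e\in Q$; and $xy=f(x)+e+g(y)$ for all $x,y\in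 Q$. The arithmetic form is strong if moreover $e\in Z(Q,+)$. *)

theory Defs
  imports "HOL-Algebra.Bij"
begin

locale quasigroup =
  fixes Q :: "'a set" and mul :: "'a \<Rightarrow> 'a \<Rightarrow> 'a" (infixl "\<cdot>" 70)
  assumes nonempty: "Q \<noteq> {}"
    and left_translation: "a \<in> Q \<Longrightarrow> bij_betw (\<lambda>x. a \<cdot> x) Q Q"
    and right_translation: "a \<in> Q \<Longrightarrow> bij_betw (\<lambda>x. x \<cdot> a) Q Q"

definition q_alpha :: "'a set \<Rightarrow> ('a \<Rightarrow> 'a \<Rightarrow> 'a) \<Rightarrow> 'a \<Rightarrow> 'a" where
  "q_alpha Q mul x = (THE u. u \<in> Q \<and> mul x u = x)"

definition q_beta :: "'a set \<Rightarrow> ('a \<Rightarrow> 'a \<Rightarrow> 'a) \<Rightarrow> 'a \<Rightarrow> 'a" where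
  "q_beta Q mul x = (THE u. u \<in> Q \<and> mul u x = x)"

locale left_F_quasigroup = quasigroup +
  assumes left_F: "\<lbrakk>x \<in> Q; y \<in> Q; z \<in> Q\<rbrakk> \<Longrightarrow> x \<cdot> (y \<cdot> z) = (x \<cdot> y) \<cdot> (q_alpha Q mul x \<cdot> z)"

locale right_F_quasigroup = quasigroup +
  assumes right_F: "\<lbrakk>x \<in> Q; y \<in> Q; z \<in> Q\<rbrakk> \<Longrightarrow> (z \<cdot> y) \<cdot> x = (z \<cdot> q_beta Q mul x) \<cdot> (y \<cdot> x)"

locale F_quasigroup = left_F_quasigroup + right_F_quasigroup

definition isotopic_to :: "'a set \<Rightarrow> ('a \<Rightarrow> 'a \<Rightarrow> 'a) \<Rightarrow> ('b, 'm) monoid_scheme \<Rightarrow> bool" where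
  "isotopic_to Q mul G \<longleftrightarrow>
    (\<exists>a b c. bij_betw a Q (carrier G) \<and> bij_betw b Q (carrier G) \<and> bij_betw c Q (carrier G) \<and>
      (\<forall>x\<in>Q. \<forall>y\<in>Q. c (mul x y) = a x \<otimes>\<^bsub>G\<^esub> b y))"

text \<open>The group is sought on the element type of the quasigroup; the lemma
  \<open>FG_quasigroupI\<close> below shows that a group over any other type serves equally well.\<close>

definition FG_quasigroup :: "'a set \<Rightarrow> ('a \<Rightarrow> 'a \<Rightarrow> 'a) \<Rightarrow> bool" where
  "FG_quasigroup Q mul \<longleftrightarrow>
    F_quasigroup Q mul \<and> (\<exists>G :: 'a monoid. group G \<and> isotopic_to Q mul G)"

lemma FG_quasigroupI:
  fixes G :: "('b, 'm) monoid_scheme"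
  assumes F: "F_quasigroup Q mul" and G: "group G" and iso: "isotopic_to Q mul G"
  shows "FG_quasigroup Q mul"
proof -
  interpret group G by (rule G)
  obtain a b c where a: "bij_betw a Q (carrier G)" and b: "bij_betw b Q (carrier G)"
    and c: "bij_betw c Q (carrier G)"
    and abc: "\<And>x y. \<lbrakk>x \<in> Q; y \<in> Q\<rbrakk> \<Longrightarrow> c (mul x y) = a x \<otimes>\<^bsub>G\<^esub> b y"
    using iso unfolding isotopic_to_def by blast
  define d where "d = inv_into Q c"
  have d: "bij_betw d (carrier G) Q"
    unfolding d_def by (rule bij_betw_inv_into[OF c])
  have cd: "c (d u) = u" if "u \<in> carrier G" for u
    unfolding d_def using bij_betw_inv_into_right[OF c that] .
  have dc: "d (c x) = x" if "x \<in> Q" for x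
    unfolding d_def using bij_betw_inv_into_left[OF c that] .
  have dQ: "d u \<in> Q" if "u \<in> carrier G" for u
    using bij_betwE[OF d] that by blast
  have cG: "c x \<in> carrier G" if "x \<in> Q" for x
    using bij_betwE[OF c] that by blast
  have aG: "a x \<in> carrier G" and bG: "b x \<in> carrier G" if "x \<in> Q" for x
    using bij_betwE[OF a] bij_betwE[OF b] that by blast+
  define P :: "'a monoid"
    where "P = \<lparr>carrier = Q, mult = (\<lambda>x y. d (c x \<otimes>\<^bsub>G\<^esub> c y)), one = d \<one>\<^bsub>G\<^esub>\<rparr>"
  have "group P"
  proof (rule groupI)
    show "\<exists>y\<in>carrier P. y \<otimes>\<^bsub>P\<^esub> x = \<one>\<^bsub>P\<^esub>" if "x \<in> carrier P" for x
      using that by (intro bexI[of _ "d (inv\<^bsub>G\<^esub> c x)"]) (simp_all add: P_def cd dQ cG)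
  qed (simp_all add: P_def cd dc dQ cG m_assoc)
  moreover have "isotopic_to Q mul P"
    unfolding isotopic_to_def
  proof (intro exI conjI ballI)
    show "bij_betw (d \<circ> a) Q (carrier P)" "bij_betw (d \<circ> b) Q (carrier P)"
      using bij_betw_trans[OF a d] bij_betw_trans[OF b d] by (simp_all add: P_def)
    show "bij_betw (d \<circ> c) Q (carrier P)"
      using bij_betw_trans[OF c d] by (simp add: P_def)
    show "(d \<circ> c) (mul x y) = (d \<circ> a) x \<otimes>\<^bsub>P\<^esub> (d \<circ> b) y" if "x \<in> Q" "y \<in> Q" for x y
      using that by (simp add: P_def abc cd aG bG)
  qed
  ultimately show ?thesis
    unfolding FG_quasigroup_def using F by blast
qed

definition group_center :: "('a, 'm) monoid_scheme \<Rightarrow> 'a set" where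
  "group_center G = {z \<in> carrier G. \<forall>x\<in>carrier G. z \<otimes>\<^bsub>G\<^esub> x = x \<otimes>\<^bsub>G\<^esub> z}"

text \<open>A five-tuple $(Q,+,f,g,e)$ is encoded as \<open>(P, f, g, e)\<close>, where the record \<open>P\<close> is the group
  $(Q,+)$, written multiplicatively. As arithmetic forms are to be counted, each must have exactly
  one representative: hence the addition is required to be extensional on $Q \times Q$, while \<open>f\<close>
  and \<open>g\<close> are extensional on $Q$ by the definition of \<open>auto\<close>; \<open>one P\<close> is determined by the addition.\<close>

definition arithmetic_forms ::
    "'a set \<Rightarrow> ('a \<Rightarrow> 'a \<Rightarrow> 'a) \<Rightarrow> ('a monoid \<times> ('a \<Rightarrow> 'a) \<times> ('a \<Rightarrow> 'a) \<times> 'a) set" where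
  "arithmetic_forms Q mul = {(P, f, g, e).
     group P \<and> carrier P = Q \<and> case_prod (mult P) \<in> extensional (Q \<times> Q) \<and>
     f \<in> auto P \<and> g \<in> auto P \<and>
     (\<forall>x\<in>Q. f (g x) = g (f x)) \<and>
     (\<forall>x\<in>Q. inv\<^bsub>P\<^esub> x \<otimes>\<^bsub>P\<^esub> f x \<in> group_center P) \<and>
     (\<forall>x\<in>Q. inv\<^bsub>P\<^esub> x \<otimes>\<^bsub>P\<^esub> g x \<in> group_center P) \<and>
     e \<in> Q \<and>
     (\<forall>x\<in>Q. \<forall>y\<in>Q. mul x y = f x \<otimes>\<^bsub>P\<^esub> e \<otimes>\<^bsub>P\<^esub> g y)}"

definition strong_arithmetic_forms ::
    "'a set \<Rightarrow> ('a \<Rightarrow> 'a \<Rightarrow> 'a) \<Rightarrow> ('a monoid \<times> ('a \<Rightarrow> 'a) \<times> ('a \<Rightarrow> 'a) \<times> 'a) set" where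
  "strong_arithmetic_forms Q mul =
     {(P, f, g, e) \<in> arithmetic_forms Q mul. e \<in> group_center P}"

definition M_set :: "'a set \<Rightarrow> ('a \<Rightarrow> 'a \<Rightarrow> 'a) \<Rightarrow> 'a set" where
  "M_set Q mul =
     {a \<in> Q. \<forall>x\<in>Q. \<forall>y\<in>Q. mul (mul x a) (mul y x) = mul (mul x y) (mul a x)}"

end

theory Submission
  imports Defs
begin

text \<open>The bijection sends an arithmetic form to the neutral element of its group.

  A form is recovered from its neutral element $0$. Indeed $e = 0 \cdot 0$,
  $f(x) = x0 - e$ and $g(y) = -e + 0y$, so that $xy = x0 - e + 0y$. Since translations are
  surjective, the quasigroup and $0$ determine the ternary expression $u - e + v$, hence also
  $u - e$ (take $v = 0$) and finally $u + v = (u + e) - e + v$.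

  Conversely, let $a \in Q$. A group isotopic to $Q$ can be transported to $Q$ in such a way that its
  neutral element is $a$, and then $xy = f(x) + e + g(y)$ for permutations $f$, $g$ fixing $a$. The
  left F-law at $x = 0$ separates variables and forces \<open>g\<close> to be additive; by duality the right
  F-law forces \<open>f\<close> to be additive. Once both are automorphisms, the left F-law becomes an identity
  in the group which says that conjugation by every $-f(x) + f(f(x))$ is trivial and that
  $fg$ and $gf$ differ by conjugation by the central element $-e + f(e)$; so $fg = gf$ and
  $-x + f(x)$ is central. Duality gives the statement about \<open>g\<close>.

  Finally, for a form with neutral element $0$ the two sides of $x0 \cdot yx = xy \cdot 0x$ differ
  only in the order of $e$ and $fg(y)$; as $fg$ is onto, $0 \in M(Q)$ says exactly that $e$ is
  central.\<close>

section \<open>The left F-law over a group\<close>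

lemma bij_betw_ex1:
  assumes "bij_betw h A B" "y \<in> B"
  shows "\<exists>!x. x \<in> A \<and> h x = y"
  using assms by (auto simp: bij_betw_def inj_on_def)

context group
begin

lemma inv_mult_cancel_left [simp]:
  "\<lbrakk>x \<in> carrier G; y \<in> carrier G\<rbrakk> \<Longrightarrow> inv x \<otimes> (x \<otimes> y) = y"
  by (simp flip: m_assoc)

lemma mult_inv_cancel_left [simp]:
  "\<lbrakk>x \<in> carrier G; y \<in> carrier G\<rbrakk> \<Longrightarrow> x \<otimes> (inv x \<otimes> y) = y"
  by (simp flip: m_assoc)

lemma group_centerI:
  assumes "z \<in> carrier G" "\<And>x. x \<in> carrier G \<Longrightarrow> z \<otimes> x = x \<otimes> z"
  shows "z \<in> group_center G"
  using assms by (simp add: group_center_def)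

lemma group_centerD:
  assumes "z \<in> group_center G"
  shows "z \<in> carrier G" "x \<in> carrier G \<Longrightarrow> z \<otimes> x = x \<otimes> z"
  using assms by (simp_all add: group_center_def)

text \<open>Over the opposite group the deviation $-x + g(x)$ reads $g(x) - x$; when the latter is
  central, this lemma identifies the two.\<close>

lemma central_quotient_commute:
  assumes "x \<in> carrier G" "y \<in> carrier G" "y \<otimes> inv x \<in> group_center G"
  shows "inv x \<otimes> y = y \<otimes> inv x"
proof -
  have "inv x \<otimes> y = inv x \<otimes> ((y \<otimes> inv x) \<otimes> x)"
    using assms by (simp add: m_assoc)
  also have "\<dots> = inv x \<otimes> (x \<otimes> (y \<otimes> inv x))"
    using assms group_centerD(2)[OF assms(3)] by simp
  finally show ?thesis using assms by simp
qed

end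

text \<open>The left F-law for $x * y = f(x) + e + g(y)$, with \<open>a\<close> in the role of $\alpha$. This is a
  locale so that it can be interpreted twice: in the group for the left F-law, and in the opposite
  group for the right one.\<close>

locale left_F_over_group = group +
  fixes f g a :: "'a \<Rightarrow> 'a" and e :: 'a and star :: "'a \<Rightarrow> 'a \<Rightarrow> 'a" (infixl "\<star>" 70)
  assumes bij_f: "bij_betw f (carrier G) (carrier G)"
    and bij_g: "bij_betw g (carrier G) (carrier G)"
    and f_one: "f \<one> = \<one>" and g_one: "g \<one> = \<one>"
    and e_closed [simp]: "e \<in> carrier G"
    and a_closed [simp]: "x \<in> carrier G \<Longrightarrow> a x \<in> carrier G"
    and star: "\<lbrakk>x \<in> carrier G; y \<in> carrier G\<rbrakk> \<Longrightarrow> x \<star> y = f x \<otimes> e \<otimes> g y"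
    and left_F: "\<lbrakk>x \<in> carrier G; y \<in> carrier G; z \<in> carrier G\<rbrakk>
      \<Longrightarrow> x \<star> (y \<star> z) = (x \<star> y) \<star> (a x \<star> z)"
begin

lemma f_closed [simp]: "x \<in> carrier G \<Longrightarrow> f x \<in> carrier G"
  using bij_betwE[OF bij_f] by blast

lemma g_closed [simp]: "x \<in> carrier G \<Longrightarrow> g x \<in> carrier G"
  using bij_betwE[OF bij_g] by blast

text \<open>At $x = 0$ the law reads $g(u + v) = H(u) + g(k + v)$ for a constant $k$ and some function
  \<open>H\<close>, because $f(y) + e$ and $g(z)$ run through the whole group. Putting $v = -k$ identifies
  $H(u)$ as $g(u - k)$, and the shift by $k$ can then be absorbed.\<close>

lemma g_hom: "g \<in> hom G G"
proof (rule homI)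
  fix p q assume p: "p \<in> carrier G" and q: "q \<in> carrier G"
  define k where "k = f (a \<one>) \<otimes> e"
  have k: "k \<in> carrier G" by (simp add: k_def)
  have separated: "\<exists>h\<in>carrier G. \<forall>v\<in>carrier G. g (u \<otimes> v) = h \<otimes> g (k \<otimes> v)" if u: "u \<in> carrier G" for u
  proof -
    obtain y where y: "y \<in> carrier G" "f y = u \<otimes> inv e"
      using bij_betw_ex1[OF bij_f, of "u \<otimes> inv e"] u by auto
    then have fy: "f y \<otimes> e = u" using u by (simp add: m_assoc)
    show ?thesis
    proof (intro bexI ballI)
      fix v assume v: "v \<in> carrier G"
      obtain z where z: "z \<in> carrier G" "g z = v"
        using bij_betw_ex1[OF bij_g v] by blast
      have "e \<otimes> g (u \<otimes> v) = f (e \<otimes> g y) \<otimes> e \<otimes> g (k \<otimes> v)"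
        using left_F[of "\<one>" y z] y(1) z u v fy k
        by (simp add: star f_one k_def)
      then have "inv e \<otimes> (e \<otimes> g (u \<otimes> v)) = inv e \<otimes> (f (e \<otimes> g y) \<otimes> e \<otimes> g (k \<otimes> v))"
        by simp
      then show "g (u \<otimes> v) = (inv e \<otimes> f (e \<otimes> g y) \<otimes> e) \<otimes> g (k \<otimes> v)"
        using y(1) u v k by (simp add: m_assoc)
    qed (use y in simp)
  qed
  obtain h where h: "h \<in> carrier G"
    and split: "\<And>v. v \<in> carrier G \<Longrightarrow> g ((p \<otimes> k) \<otimes> v) = h \<otimes> g (k \<otimes> v)"
    using separated[OF m_closed[OF p k]] by blast
  have "g p = h"
    using split[of "inv k"] p k h by (simp add: m_assoc g_one)
  then show "g (p \<otimes> q) = g p \<otimes> g q"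
    using split[of "inv k \<otimes> q"] p q k by (simp add: m_assoc)
qed simp

lemma left_F_expanded:
  assumes f: "f \<in> hom G G" and x: "x \<in> carrier G" and y: "y \<in> carrier G"
  shows "f x \<otimes> (e \<otimes> g (f y)) = f (f x) \<otimes> (f e \<otimes> (f (g y) \<otimes> (e \<otimes> g (f (a x)))))"
proof -
  have "x \<star> (y \<star> \<one>) = (x \<star> y) \<star> (a x \<star> \<one>)" using x y left_F by simp
  then have "(f x \<otimes> (e \<otimes> g (f y))) \<otimes> g e
      = (f (f x) \<otimes> (f e \<otimes> (f (g y) \<otimes> (e \<otimes> g (f (a x)))))) \<otimes> g e"
    using x y hom_mult[OF f] hom_mult[OF g_hom] by (simp add: star g_one m_assoc)
  then show ?thesis using x y by (subst (asm) right_cancel) simp_all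
qed

text \<open>Setting $y = 0$ in the expanded law eliminates $\alpha$. What is left says that the
  conjugate of $f(e) + fg(y) - f(e)$ by $-f(x) + ff(x)$ does not depend on \<open>x\<close>.\<close>

lemma conjugation_identity:
  assumes f: "f \<in> hom G G" and x: "x \<in> carrier G" and y: "y \<in> carrier G"
  defines "t \<equiv> inv (f x) \<otimes> f (f x)"
  shows "e \<otimes> (g (f y) \<otimes> inv e) = t \<otimes> (f e \<otimes> (f (g y) \<otimes> (inv (f e) \<otimes> inv t)))"
proof -
  have "f x \<otimes> e = f (f x) \<otimes> (f e \<otimes> (e \<otimes> g (f (a x))))"
    using left_F_expanded[OF f x one_closed] x by (simp add: f_one g_one)
  then have "inv (f e) \<otimes> (inv (f (f x)) \<otimes> (f x \<otimes> e)) = e \<otimes> g (f (a x))"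
    using x by simp
  with left_F_expanded[OF f x y] have
    "f x \<otimes> (e \<otimes> g (f y))
      = f (f x) \<otimes> (f e \<otimes> (f (g y) \<otimes> (inv (f e) \<otimes> (inv (f (f x)) \<otimes> (f x \<otimes> e)))))"
    by simp
  then have "inv (f x) \<otimes> (f x \<otimes> (e \<otimes> g (f y))) \<otimes> inv e
    = inv (f x) \<otimes> (f (f x) \<otimes> (f e \<otimes> (f (g y) \<otimes> (inv (f e) \<otimes> (inv (f (f x)) \<otimes> (f x \<otimes> e)))))) \<otimes> inv e"
    by simp
  then show ?thesis using x y by (simp add: t_def m_assoc inv_mult_group)
qed

lemma conjugation_identity_one:
  assumes f: "f \<in> hom G G" and y: "y \<in> carrier G"
  shows "e \<otimes> (g (f y) \<otimes> inv e) = f e \<otimes> (f (g y) \<otimes> inv (f e))"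
  using conjugation_identity[OF f one_closed y] y by (simp add: f_one)

lemma f_deviation_central:
  assumes f: "f \<in> hom G G" and x: "x \<in> carrier G"
  shows "inv x \<otimes> f x \<in> group_center G"
proof (rule group_centerI)
  fix w assume w: "w \<in> carrier G"
  obtain x' where x': "x' \<in> carrier G" "f x' = x"
    using bij_betw_ex1[OF bij_f x] by blast
  \<comment> \<open>every \<open>w\<close> has the form $e + gf(y) - e$\<close>
  obtain y0 where y0: "y0 \<in> carrier G" "g y0 = inv e \<otimes> (w \<otimes> e)"
    using bij_betw_ex1[OF bij_g, of "inv e \<otimes> (w \<otimes> e)"] w by auto
  obtain y where y: "y \<in> carrier G" "f y = y0"
    using bij_betw_ex1[OF bij_f y0(1)] by blast
  have w_eq: "w = e \<otimes> (g (f y) \<otimes> inv e)"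
    using y y0 w by (simp add: m_assoc)
  define t where "t = inv x \<otimes> f x"
  have t: "t \<in> carrier G" using x by (simp add: t_def)
  have "w = t \<otimes> (f e \<otimes> (f (g y) \<otimes> (inv (f e) \<otimes> inv t)))"
    using conjugation_identity[OF f x'(1) y(1)] by (simp add: w_eq t_def x')
  also have "\<dots> = t \<otimes> ((f e \<otimes> (f (g y) \<otimes> inv (f e))) \<otimes> inv t)"
    using y t by (simp add: m_assoc)
  also have "\<dots> = t \<otimes> (w \<otimes> inv t)"
    using conjugation_identity_one[OF f y(1)] by (simp add: w_eq)
  finally have "w \<otimes> t = t \<otimes> (w \<otimes> inv t) \<otimes> t" by simp
  then show "inv x \<otimes> f x \<otimes> w = w \<otimes> (inv x \<otimes> f x)"
    using w t by (simp add: m_assoc flip: t_def)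
qed (use x in simp)

lemma f_g_commute:
  assumes f: "f \<in> hom G G" and y: "y \<in> carrier G"
  shows "f (g y) = g (f y)"
proof -
  define c where "c = inv e \<otimes> f e"
  have c: "c \<in> group_center G"
    unfolding c_def using f_deviation_central[OF f] by simp
  note cc = group_centerD[OF c]
  have fe: "f e = e \<otimes> c" using c by (simp add: c_def)
  have "f e \<otimes> (f (g y) \<otimes> inv (f e)) = e \<otimes> ((c \<otimes> f (g y)) \<otimes> (inv c \<otimes> inv e))"
    using y cc(1) by (simp add: fe m_assoc inv_mult_group)
  also have "\<dots> = e \<otimes> (f (g y) \<otimes> inv e)"
    using y cc by (simp add: m_assoc)
  finally show ?thesis
    using conjugation_identity_one[OF f y] y by simp
qed

end

section \<open>Duality\<close>

definition opposite :: "('a, 'm) monoid_scheme \<Rightarrow> ('a, 'm) monoid_scheme" where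
  "opposite G = G\<lparr>mult := \<lambda>x y. y \<otimes>\<^bsub>G\<^esub> x\<rparr>"

lemma opposite_simps [simp]:
  "carrier (opposite G) = carrier G" "one (opposite G) = one G"
  "x \<otimes>\<^bsub>opposite G\<^esub> y = y \<otimes>\<^bsub>G\<^esub> x"
  by (simp_all add: opposite_def)

lemma group_center_opposite [simp]: "group_center (opposite G) = group_center G"
  unfolding group_center_def by (simp add: eq_commute)

lemma hom_opposite_iff: "h \<in> hom (opposite G) (opposite G) \<longleftrightarrow> h \<in> hom G G"
  unfolding hom_def by auto

context group
begin

lemma group_opposite: "group (opposite G)"
proof (rule groupI)
  show "\<exists>y\<in>carrier (opposite G). y \<otimes>\<^bsub>opposite G\<^esub> x = \<one>\<^bsub>opposite G\<^esub>"
    if "x \<in> carrier (opposite G)" for x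
    using that by (intro bexI[of _ "inv x"]) simp_all
qed (simp_all add: m_assoc)

lemma inv_opposite: "x \<in> carrier G \<Longrightarrow> inv\<^bsub>opposite G\<^esub> x = inv x"
  using group.inv_equality[OF group_opposite, of "inv x" x] by simp

end

section \<open>Quasigroups\<close>

lemma (in quasigroup) mul_closed: "\<lbrakk>x \<in> Q; y \<in> Q\<rbrakk> \<Longrightarrow> x \<cdot> y \<in> Q"
  using bij_betwE[OF left_translation] by blast

lemma (in quasigroup) q_alpha_closed:
  assumes "x \<in> Q"
  shows "q_alpha Q mul x \<in> Q"
proof -
  have "\<exists>!u. u \<in> Q \<and> x \<cdot> u = x"
    by (rule bij_betw_ex1[OF left_translation[OF assms] assms])
  from theI'[OF this] show ?thesis by (simp add: q_alpha_def)
qed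

lemma (in quasigroup) q_beta_closed:
  assumes "x \<in> Q"
  shows "q_beta Q mul x \<in> Q"
proof -
  have "\<exists>!u. u \<in> Q \<and> u \<cdot> x = x"
    by (rule bij_betw_ex1[OF right_translation[OF assms] assms])
  from theI'[OF this] show ?thesis by (simp add: q_beta_def)
qed

text \<open>The right F-law is the left F-law of the opposite quasigroup over the opposite group, with
  the roles of \<open>f\<close> and \<open>g\<close> exchanged.\<close>

lemma (in F_quasigroup) arithmetic_form_over_group:
  assumes "group P" and carrier: "carrier P = Q"
    and ext: "case_prod (mult P) \<in> extensional (Q \<times> Q)"
    and f: "f \<in> Bij Q" "f \<one>\<^bsub>P\<^esub> = \<one>\<^bsub>P\<^esub>" and g: "g \<in> Bij Q" "g \<one>\<^bsub>P\<^esub> = \<one>\<^bsub>P\<^esub>"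
    and e: "e \<in> Q"
    and mul: "\<And>x y. \<lbrakk>x \<in> Q; y \<in> Q\<rbrakk> \<Longrightarrow> x \<cdot> y = f x \<otimes>\<^bsub>P\<^esub> e \<otimes>\<^bsub>P\<^esub> g y"
  shows "(P, f, g, e) \<in> arithmetic_forms Q mul"
proof -
  interpret P: group P by fact
  have bij: "bij_betw f Q Q" "bij_betw g Q Q"
    using f g by (simp_all add: Bij_def)
  then have closed: "f x \<in> Q" "g x \<in> Q" if "x \<in> Q" for x
    using that by (auto dest: bij_betwE)
  interpret L: left_F_over_group P f g "q_alpha Q mul" e mul
    by unfold_locales (simp_all add: carrier bij f g e q_alpha_closed left_F, simp add: mul)
  interpret R: left_F_over_group "opposite P" g f "q_beta Q mul" e "\<lambda>x y. mul y x"
    by (intro left_F_over_group.intro P.group_opposite left_F_over_group_axioms.intro)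
      (simp_all add: carrier bij f g e q_beta_closed right_F,
       simp add: mul closed e P.m_assoc carrier)
  have homs: "f \<in> hom P P" "g \<in> hom P P"
    using L.g_hom R.g_hom by (simp_all add: hom_opposite_iff)
  have central_g: "inv\<^bsub>P\<^esub> x \<otimes>\<^bsub>P\<^esub> g x \<in> group_center P" if x: "x \<in> Q" for x
  proof -
    have "g x \<otimes>\<^bsub>P\<^esub> inv\<^bsub>P\<^esub> x \<in> group_center P"
      using R.f_deviation_central[of x] homs x
      by (simp add: hom_opposite_iff carrier P.inv_opposite)
    with P.central_quotient_commute[of x "g x"] x closed show ?thesis
      by (simp add: carrier)
  qed
  show ?thesis
    unfolding arithmetic_forms_def auto_def
    using assms(1) carrier ext f g e homs central_g
      L.f_deviation_central[OF homs(1)] L.f_g_commute[OF homs(1)]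
    by (simp add: mul carrier)
qed

section \<open>Every element is the neutral element of exactly one form\<close>

text \<open>If $c(xy) = A(x) + B(y)$ in \<open>G\<close>, then $u \oplus v = c^{-1}(c(u) - c(a) + c(v))$ is a group
  operation on \<open>Q\<close> with neutral element \<open>a\<close>, and $xy = c^{-1}(A(x) + c(a)) \oplus c^{-1}(B(y))$.\<close>

lemma (in quasigroup) isotopic_group_with_neutral:
  fixes G :: "('b, 'm) monoid_scheme"
  assumes "group G" and "isotopic_to Q mul G" and a: "a \<in> Q"
  obtains P :: "'a monoid" and p q where "group P" "carrier P = Q" "\<one>\<^bsub>P\<^esub> = a"
    "case_prod (mult P) \<in> extensional (Q \<times> Q)"
    "\<And>x. x \<in> Q \<Longrightarrow> p x \<in> Q" "\<And>x. x \<in> Q \<Longrightarrow> q x \<in> Q"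
    "\<And>x y. \<lbrakk>x \<in> Q; y \<in> Q\<rbrakk> \<Longrightarrow> x \<cdot> y = p x \<otimes>\<^bsub>P\<^esub> q y"
proof -
  interpret G: group G by fact
  obtain A B c where A: "bij_betw A Q (carrier G)" and B: "bij_betw B Q (carrier G)"
    and c: "bij_betw c Q (carrier G)"
    and ABc: "\<And>x y. \<lbrakk>x \<in> Q; y \<in> Q\<rbrakk> \<Longrightarrow> c (x \<cdot> y) = A x \<otimes>\<^bsub>G\<^esub> B y"
    using assms(2) unfolding isotopic_to_def by blast
  define d where "d = inv_into Q c"
  have cd: "c (d u) = u" if "u \<in> carrier G" for u
    unfolding d_def using bij_betw_inv_into_right[OF c that] .
  have dc: "d (c x) = x" if "x \<in> Q" for x
    unfolding d_def using bij_betw_inv_into_left[OF c that] .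
  have dQ: "d u \<in> Q" if "u \<in> carrier G" for u
    using bij_betwE[OF bij_betw_inv_into[OF c]] that by (simp add: d_def)
  have G: "A x \<in> carrier G" "B x \<in> carrier G" "c x \<in> carrier G" if "x \<in> Q" for x
    using bij_betwE[OF A] bij_betwE[OF B] bij_betwE[OF c] that by blast+
  define P :: "'a monoid" where "P = \<lparr>carrier = Q,
    mult = curry (restrict (\<lambda>(x, y). d (c x \<otimes>\<^bsub>G\<^esub> inv\<^bsub>G\<^esub> c a \<otimes>\<^bsub>G\<^esub> c y)) (Q \<times> Q)), one = a\<rparr>"
  have P [simp]: "carrier P = Q" "\<one>\<^bsub>P\<^esub> = a"
    by (simp_all add: P_def)
  have mult: "x \<otimes>\<^bsub>P\<^esub> y = d (c x \<otimes>\<^bsub>G\<^esub> inv\<^bsub>G\<^esub> c a \<otimes>\<^bsub>G\<^esub> c y)" if "x \<in> Q" "y \<in> Q" for x y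
    using that by (simp add: P_def)
  show thesis
  proof (rule that[of P "\<lambda>x. d (A x \<otimes>\<^bsub>G\<^esub> c a)" "\<lambda>y. d (B y)"])
    show "group P"
    proof (rule groupI)
      show "\<exists>y\<in>carrier P. y \<otimes>\<^bsub>P\<^esub> x = \<one>\<^bsub>P\<^esub>" if "x \<in> carrier P" for x
        using that a
        by (intro bexI[of _ "d (c a \<otimes>\<^bsub>G\<^esub> inv\<^bsub>G\<^esub> c x \<otimes>\<^bsub>G\<^esub> c a)"])
          (simp_all add: mult cd dc dQ G G.m_assoc)
    qed (use a in \<open>simp_all add: mult cd dc dQ G G.m_assoc\<close>)
    show "case_prod (mult P) \<in> extensional (Q \<times> Q)"
      by (simp add: P_def)
    show "x \<cdot> y = d (A x \<otimes>\<^bsub>G\<^esub> c a) \<otimes>\<^bsub>P\<^esub> d (B y)" if "x \<in> Q" "y \<in> Q" for x y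
    proof -
      have "x \<cdot> y = d (A x \<otimes>\<^bsub>G\<^esub> B y)"
        using dc[OF mul_closed[OF that]] ABc[OF that] by simp
      then show ?thesis using that a by (simp add: mult cd dQ G G.m_assoc)
    qed
  qed (use a in \<open>simp_all add: dQ G\<close>)
qed

lemma (in F_quasigroup) ex_arithmetic_form_with_neutral:
  assumes "group G" and "isotopic_to Q mul G" and a: "a \<in> Q"
  shows "\<exists>F\<in>arithmetic_forms Q mul. \<one>\<^bsub>fst F\<^esub> = a"
proof -
  obtain P :: "'a monoid" and p q where "group P" and carrier: "carrier P = Q" and one: "\<one>\<^bsub>P\<^esub> = a"
    and ext: "case_prod (mult P) \<in> extensional (Q \<times> Q)"
    and closed: "\<And>x. x \<in> Q \<Longrightarrow> p x \<in> Q" "\<And>x. x \<in> Q \<Longrightarrow> q x \<in> Q"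
    and pq: "\<And>x y. \<lbrakk>x \<in> Q; y \<in> Q\<rbrakk> \<Longrightarrow> x \<cdot> y = p x \<otimes>\<^bsub>P\<^esub> q y"
    using isotopic_group_with_neutral[OF assms] by blast
  interpret P: group P by fact
  note P_closed = P.m_closed[unfolded carrier] P.inv_closed[unfolded carrier]
  define e where "e = a \<cdot> a"
  define f where "f = (\<lambda>x\<in>Q. x \<cdot> a \<otimes>\<^bsub>P\<^esub> inv\<^bsub>P\<^esub> e)"
  define g where "g = (\<lambda>y\<in>Q. inv\<^bsub>P\<^esub> e \<otimes>\<^bsub>P\<^esub> (a \<cdot> y))"
  have e: "e \<in> Q" using a by (simp add: e_def mul_closed)
  \<comment> \<open>\<open>f\<close> and \<open>g\<close> are defined by translations, which makes them bijective; in terms of \<open>p\<close> and \<open>q\<close>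
     it is clear that they fix \<open>a\<close>\<close>
  have f_eq: "f x = p x \<otimes>\<^bsub>P\<^esub> inv\<^bsub>P\<^esub> p a" and g_eq: "g x = inv\<^bsub>P\<^esub> q a \<otimes>\<^bsub>P\<^esub> q x" if "x \<in> Q" for x
    using that a closed
    by (simp_all add: f_def g_def e_def pq carrier P_closed P.inv_mult_group P.m_assoc)
  have "bij_betw (\<lambda>u. u \<otimes>\<^bsub>P\<^esub> inv\<^bsub>P\<^esub> e) Q Q"
    using e by (intro bij_betwI[where g = "\<lambda>u. u \<otimes>\<^bsub>P\<^esub> e"]) (auto simp: P.m_assoc simp flip: carrier)
  from bij_betw_trans[OF right_translation[OF a] this] have f_Bij: "f \<in> Bij Q"
    by (simp add: Bij_def f_def comp_def)
  have "bij_betw (\<lambda>u. inv\<^bsub>P\<^esub> e \<otimes>\<^bsub>P\<^esub> u) Q Q"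
    using e by (intro bij_betwI[where g = "\<lambda>u. e \<otimes>\<^bsub>P\<^esub> u"]) (auto simp flip: carrier)
  from bij_betw_trans[OF left_translation[OF a] this] have g_Bij: "g \<in> Bij Q"
    by (simp add: Bij_def g_def comp_def)
  have "(P, f, g, e) \<in> arithmetic_forms Q mul"
  proof (rule arithmetic_form_over_group[OF \<open>group P\<close> carrier ext f_Bij _ g_Bij _ e])
    show "f \<one>\<^bsub>P\<^esub> = \<one>\<^bsub>P\<^esub>" "g \<one>\<^bsub>P\<^esub> = \<one>\<^bsub>P\<^esub>"
      using a closed by (simp_all add: one f_eq g_eq carrier P_closed flip: one)
    show "x \<cdot> y = f x \<otimes>\<^bsub>P\<^esub> e \<otimes>\<^bsub>P\<^esub> g y" if "x \<in> Q" "y \<in> Q" for x y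
      using that a closed by (simp add: f_eq g_eq e_def pq carrier P_closed P.inv_mult_group P.m_assoc)
  qed
  with one show ?thesis by force
qed

lemma arithmetic_formsD:
  assumes "(P, f, g, e) \<in> arithmetic_forms Q mul"
  shows "group P" "carrier P = Q" "case_prod (mult P) \<in> extensional (Q \<times> Q)"
    "f \<in> hom P P" "g \<in> hom P P" "f \<in> Bij Q" "g \<in> Bij Q"
    "f \<one>\<^bsub>P\<^esub> = \<one>\<^bsub>P\<^esub>" "g \<one>\<^bsub>P\<^esub> = \<one>\<^bsub>P\<^esub>" "e \<in> Q"
    "\<And>x. x \<in> Q \<Longrightarrow> f (g x) = g (f x)"
    "\<And>x. x \<in> Q \<Longrightarrow> f x \<in> Q" "\<And>x. x \<in> Q \<Longrightarrow> g x \<in> Q"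
    "\<And>x y. \<lbrakk>x \<in> Q; y \<in> Q\<rbrakk> \<Longrightarrow> mul x y = f x \<otimes>\<^bsub>P\<^esub> e \<otimes>\<^bsub>P\<^esub> g y"
proof -
  show *: "group P" "carrier P = Q" "case_prod (mult P) \<in> extensional (Q \<times> Q)"
    "f \<in> hom P P" "g \<in> hom P P" "f \<in> Bij Q" "g \<in> Bij Q" "e \<in> Q"
    "\<And>x. x \<in> Q \<Longrightarrow> f (g x) = g (f x)"
    "\<And>x y. \<lbrakk>x \<in> Q; y \<in> Q\<rbrakk> \<Longrightarrow> mul x y = f x \<otimes>\<^bsub>P\<^esub> e \<otimes>\<^bsub>P\<^esub> g y"
    using assms unfolding arithmetic_forms_def auto_def by auto
  show "f \<one>\<^bsub>P\<^esub> = \<one>\<^bsub>P\<^esub>" "g \<one>\<^bsub>P\<^esub> = \<one>\<^bsub>P\<^esub>"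
    using hom_one[OF *(4)] hom_one[OF *(5)] *(1) by simp_all
  show "\<And>x. x \<in> Q \<Longrightarrow> f x \<in> Q" "\<And>x. x \<in> Q \<Longrightarrow> g x \<in> Q"
    using hom_in_carrier[OF *(4)] hom_in_carrier[OF *(5)] *(2) by simp_all
qed

lemma arithmetic_form_parameters:
  assumes F: "(P, f, g, e) \<in> arithmetic_forms Q mul"
  shows "e = mul \<one>\<^bsub>P\<^esub> \<one>\<^bsub>P\<^esub>"
    and "x \<in> Q \<Longrightarrow> f x = mul x \<one>\<^bsub>P\<^esub> \<otimes>\<^bsub>P\<^esub> inv\<^bsub>P\<^esub> e"
    and "x \<in> Q \<Longrightarrow> g x = inv\<^bsub>P\<^esub> e \<otimes>\<^bsub>P\<^esub> mul \<one>\<^bsub>P\<^esub> x"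
proof -
  note D = arithmetic_formsD[OF F]
  interpret P: group P by (rule D)
  note P_closed = P.m_closed[unfolded D(2)] P.inv_closed[unfolded D(2)]
  have [simp]: "\<one>\<^bsub>P\<^esub> \<in> Q" using P.one_closed D(2) by simp
  show "e = mul \<one>\<^bsub>P\<^esub> \<one>\<^bsub>P\<^esub>"
    by (simp add: D)
  show "f x = mul x \<one>\<^bsub>P\<^esub> \<otimes>\<^bsub>P\<^esub> inv\<^bsub>P\<^esub> e" "g x = inv\<^bsub>P\<^esub> e \<otimes>\<^bsub>P\<^esub> mul \<one>\<^bsub>P\<^esub> x" if "x \<in> Q"
    using that by (simp_all add: D P_closed P.m_assoc)
qed

text \<open>Both forms compute $x0 - e + 0y$ as $xy$, so their ternary operations $u - e + v$ agree, and
  the binary ones do because $u + v = (u + e) - e + v$.\<close>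

lemma (in quasigroup) arithmetic_form_unique:
  assumes F: "(P, f, g, e) \<in> arithmetic_forms Q mul"
    and F': "(P', f', g', e') \<in> arithmetic_forms Q mul"
    and one: "\<one>\<^bsub>P\<^esub> = \<one>\<^bsub>P'\<^esub>"
  shows "(P, f, g, e) = (P', f', g', e')"
proof -
  note D = arithmetic_formsD[OF F] and D' = arithmetic_formsD[OF F']
  note par = arithmetic_form_parameters[OF F] and par' = arithmetic_form_parameters[OF F']
  interpret P: group P by (rule D)
  note P_closed = P.m_closed[unfolded D(2)] P.inv_closed[unfolded D(2)]
  interpret P': group P' by (rule D')
  note P'_closed = P'.m_closed[unfolded D'(2)] P'.inv_closed[unfolded D'(2)]
  have one_Q: "\<one>\<^bsub>P\<^esub> \<in> Q" using P.one_closed D(2) by simp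
  have e: "e' = e" using par(1) par'(1) one by simp
  have ternary: "u \<otimes>\<^bsub>P\<^esub> inv\<^bsub>P\<^esub> e \<otimes>\<^bsub>P\<^esub> v = u \<otimes>\<^bsub>P'\<^esub> inv\<^bsub>P'\<^esub> e \<otimes>\<^bsub>P'\<^esub> v" if uv: "u \<in> Q" "v \<in> Q" for u v
  proof -
    obtain x where x: "x \<in> Q" "x \<cdot> \<one>\<^bsub>P\<^esub> = u"
      using bij_betw_ex1[OF right_translation[OF one_Q] uv(1)] by blast
    obtain y where y: "y \<in> Q" "\<one>\<^bsub>P\<^esub> \<cdot> y = v"
      using bij_betw_ex1[OF left_translation[OF one_Q] uv(2)] by blast
    have "x \<cdot> y = u \<otimes>\<^bsub>P\<^esub> inv\<^bsub>P\<^esub> e \<otimes>\<^bsub>P\<^esub> v"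
      using D(14)[OF x(1) y(1)] uv par(2)[OF x(1)] par(3)[OF y(1)] D(2,10) x y
      by (simp add: P_closed P.m_assoc)
    moreover have "x \<cdot> y = u \<otimes>\<^bsub>P'\<^esub> inv\<^bsub>P'\<^esub> e \<otimes>\<^bsub>P'\<^esub> v"
      using D'(14)[OF x(1) y(1)] uv par'(2)[OF x(1)] par'(3)[OF y(1)] D'(2,10) x[unfolded one] y[unfolded one]
      by (simp add: P'_closed P'.m_assoc e)
    ultimately show ?thesis by simp
  qed
  have mult_Q: "u \<otimes>\<^bsub>P\<^esub> v = u \<otimes>\<^bsub>P'\<^esub> v" if uv: "u \<in> Q" "v \<in> Q" for u v
  proof -
    define w where "w = u \<otimes>\<^bsub>P\<^esub> e"
    have w: "w \<in> Q" using uv D(10) by (simp add: w_def P_closed)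
    have w_e: "w \<otimes>\<^bsub>P\<^esub> inv\<^bsub>P\<^esub> e = u"
      using uv D(2,10) by (simp add: w_def P_closed P.m_assoc)
    have "w \<otimes>\<^bsub>P'\<^esub> inv\<^bsub>P'\<^esub> e = u"
      using ternary[OF w one_Q] w_e w uv D(2,10) D'(2) P.r_one[of u]
      by (simp add: one P'_closed)
    with ternary[OF w uv(2)] w_e show ?thesis by simp
  qed
  have "case_prod (mult P) = case_prod (mult P')"
    by (rule extensionalityI[OF D(3) D'(3)]) (auto simp: mult_Q)
  then have "mult P = mult P'"
    by (metis curry_case_prod)
  then have P: "P = P'"
    using one D(2) D'(2) by (intro monoid.equality) simp_all
  have "f = f'" "g = g'"
    using D(6,7) D'(6,7) par(2,3) par'(2,3)
    by (auto intro!: extensionalityI[where A = Q] simp: Bij_def P e)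
  with P e show ?thesis by simp
qed

section \<open>Strong forms\<close>

text \<open>With $a = 0$ the two sides of the identity defining $M(Q)$ are
  $ff(x) + f(e) + e + gf(y) + g(e) + gg(x)$ and the same sum with $e$ and $gf(y) = fg(y)$
  exchanged.\<close>

lemma arithmetic_form_strong_iff:
  assumes F: "(P, f, g, e) \<in> arithmetic_forms Q mul"
  shows "e \<in> group_center P \<longleftrightarrow> \<one>\<^bsub>P\<^esub> \<in> M_set Q mul"
proof -
  note D = arithmetic_formsD[OF F]
  interpret P: group P by (rule D)
  note P_closed = P.m_closed[unfolded D(2)] P.inv_closed[unfolded D(2)]
  have one_Q: "\<one>\<^bsub>P\<^esub> \<in> Q" using P.one_closed D(2) by simp
  have fg_add: "f (u \<otimes>\<^bsub>P\<^esub> v) = f u \<otimes>\<^bsub>P\<^esub> f v" "g (u \<otimes>\<^bsub>P\<^esub> v) = g u \<otimes>\<^bsub>P\<^esub> g v"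
    if "u \<in> Q" "v \<in> Q" for u v
    using that hom_mult[OF D(4)] hom_mult[OF D(5)] D(2) by simp_all
  have M_iff: "mul (mul x \<one>\<^bsub>P\<^esub>) (mul y x) = mul (mul x y) (mul \<one>\<^bsub>P\<^esub> x) \<longleftrightarrow>
      e \<otimes>\<^bsub>P\<^esub> f (g y) = f (g y) \<otimes>\<^bsub>P\<^esub> e" (is "?lhs = ?rhs \<longleftrightarrow> _") if x: "x \<in> Q" and y: "y \<in> Q" for x y
  proof -
    define l where "l = f (f x) \<otimes>\<^bsub>P\<^esub> f e"
    define r where "r = g e \<otimes>\<^bsub>P\<^esub> g (g x)"
    have lr: "l \<in> Q" "r \<in> Q" using x D(10,12,13) by (simp_all add: l_def r_def P_closed)
    have "?lhs = l \<otimes>\<^bsub>P\<^esub> ((e \<otimes>\<^bsub>P\<^esub> f (g y)) \<otimes>\<^bsub>P\<^esub> r)" "?rhs = l \<otimes>\<^bsub>P\<^esub> ((f (g y) \<otimes>\<^bsub>P\<^esub> e) \<otimes>\<^bsub>P\<^esub> r)"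
      using x y one_Q D(2)
      by (simp_all add: D(8-14) P_closed fg_add l_def r_def P.m_assoc)
    then show ?thesis
      using lr D(2,10,12,13) y by (simp add: P_closed)
  qed
  have bij: "bij_betw f Q Q" "bij_betw g Q Q"
    using D(6,7) by (simp_all add: Bij_def)
  have surj: "\<exists>y\<in>Q. f (g y) = w" if "w \<in> Q" for w
  proof -
    obtain y0 where y0: "y0 \<in> Q" "f y0 = w"
      using bij_betw_ex1[OF bij(1) \<open>w \<in> Q\<close>] by blast
    then obtain y where "y \<in> Q" "g y = y0"
      using bij_betw_ex1[OF bij(2)] by blast
    with y0 show ?thesis by blast
  qed
  show ?thesis
  proof
    assume e_central: "e \<in> group_center P"
    have "e \<otimes>\<^bsub>P\<^esub> f (g y) = f (g y) \<otimes>\<^bsub>P\<^esub> e" if "y \<in> Q" for y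
      using P.group_centerD(2)[OF e_central, of "f (g y)"] that D(2,12,13) by simp
    with one_Q M_iff show "\<one>\<^bsub>P\<^esub> \<in> M_set Q mul"
      by (simp add: M_set_def)
  next
    assume "\<one>\<^bsub>P\<^esub> \<in> M_set Q mul"
    then have "e \<otimes>\<^bsub>P\<^esub> f (g y) = f (g y) \<otimes>\<^bsub>P\<^esub> e" if "y \<in> Q" for y
      using that one_Q M_iff[OF that that] by (simp add: M_set_def)
    then show "e \<in> group_center P"
      using surj D(2,10) by (intro P.group_centerI) metis+
  qed
qed

section \<open>The bijection\<close>

theorem theorem6p4:
  fixes Q :: "'a set" and mul :: "'a \<Rightarrow> 'a \<Rightarrow> 'a"
  assumes "FG_quasigroup Q mul"
  shows "\<exists>h. bij_betw h (arithmetic_forms Q mul) Q \<and>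
             bij_betw h (strong_arithmetic_forms Q mul) (M_set Q mul)"
proof -
  from assms obtain G :: "'a monoid" where "F_quasigroup Q mul" and G: "group G" "isotopic_to Q mul G"
    unfolding FG_quasigroup_def by blast
  then interpret F_quasigroup Q mul by simp
  let ?h = "\<lambda>F. \<one>\<^bsub>fst F\<^esub>"
  have neutral_Q: "?h F \<in> Q" if "F \<in> arithmetic_forms Q mul" for F
    using that arithmetic_formsD(1,2) group.is_monoid monoid.one_closed
    by (cases F) fastforce
  have inj: "inj_on ?h (arithmetic_forms Q mul)"
    using arithmetic_form_unique by (fastforce intro!: inj_onI)
  have image: "?h ` arithmetic_forms Q mul = Q"
    using neutral_Q ex_arithmetic_form_with_neutral[OF G] by fastforce
  have strong: "strong_arithmetic_forms Q mul = {F \<in> arithmetic_forms Q mul. ?h F \<in> M_set Q mul}"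
    unfolding strong_arithmetic_forms_def using arithmetic_form_strong_iff by fastforce
  have "?h ` strong_arithmetic_forms Q mul = M_set Q mul"
    using image unfolding strong M_set_def by fastforce
  moreover have "inj_on ?h (strong_arithmetic_forms Q mul)"
    using inj unfolding strong by (rule inj_on_subset) auto
  ultimately show ?thesis
    using inj image unfolding bij_betw_def by blast
qed

end
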